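(* For every $\delta>0$ there exists $d_0$ such that the following holds for all constants $a>b\ge0$. Let $d=\frac{a+b}{2}$ and $\lambda(a,b)=\frac{a-b}{\sqrt{2(a+b)}}$. If $d>d_0$ and $\lambda(a,b)>8+\delta$, then there exists $\varepsilon>0$ such that, when $A$ is the adjacency matrix of the two-community Stochastic Block Model on an even number $n$ of nodes with label vector $g\in\{\pm1\}^n$, $g^T\mathbf{1}=0$, and with connection probabilities $p=\frac an$, $q=\frac bn$, and $A^\natural=A-\frac{p+q}{2}\mathbf{1}\mathbf{1}^T$, then with high probability every second-order critical point $Q\in\mathbb{R}^{n\times 2}$ of $$\max_{Q\in\mathbb{R}^{n\times2}}\operatorname{Tr}(Q^TA^\natural Q)\quad\text{s.t. }\|Q_{i:}\|_2^2=1,\ 1\le i\le n,$$ satisfies $$\frac1n\|Q^Tg\|_2\ge\varepsilon.$$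
   Context: Stochastic Block Model on two communities: $n=2m$ nodes are split evenly into two communities, encoded by a fixed $g\in\{\pm1\}^n$ with $g^T\mathbf{1}=0$ ($\mathbf 1$ is the all-ones vector). The random adjacency matrix $A$ is symmetric with independent entries $A_{ij}$, $i\le j$; $A_{ij}=1$ with probability $p$ and $0$ with probability $1-p$ if $g_ig_j=1$ (including the diagonal $i=j$), and $A_{ij}=1$ with probability $q$ and $0$ with probability $1-q$ if $g_ig_j=-1$. "With high probability" means with probability tending to $1$ as $n\to\infty$ (with $a,b$ fixed). $Q_{i:}$ denotes the $i$th row of $Q$. The operator $\mathrm{ddiag}$ maps a square matrix to the diagonal matrix obtained by setting all off-diagonal entries to zero; $\circ$ is the entrywise (Hadamard) product. For a symmetric cost matrix $M\in\mathbb{R}^{n\times n}$, a second-order critical point of $\max\{\operatorname{Tr}(Q^TMQ): Q\in\mathbb{R}^{n\times 2},\ \|Q_{i:}\|_2=1\ \forall i\}$ is a feasible $Q$ satisfying the first-order condition $(\mathrm{ddiag}(MQQ^T)-M)Q=0$ and the second-order condition $\mathrm{ddiag}(MQQ^T)-M\circ(QQ^T)\succeq 0$. *)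

theory Defs
  imports "HOL-Probability.Probability" "Jordan_Normal_Form.Matrix"
begin

unbundle no inner_syntax
unbundle no vec_syntax
hide_type (open) Finite_Cartesian_Product.vec
hide_const (open) Finite_Cartesian_Product.vec Finite_Cartesian_Product.row
  Finite_Cartesian_Product.mat

definition l2_norm :: "real vec \<Rightarrow> real" where
  "l2_norm v = sqrt (v \<bullet> v)"

definition psd :: "nat \<Rightarrow> real mat \<Rightarrow> bool" where
  "psd n X \<longleftrightarrow> X \<in> carrier_mat n n \<and> X\<^sup>T = X \<and>
     (\<forall>x \<in> carrier_vec n. 0 \<le> x \<bullet> (X *\<^sub>v x))"

definition ddiag :: "real mat \<Rightarrow> real mat" where
  "ddiag X = mat_diag (dim_row X) (\<lambda>i. X $$ (i, i))"

definition hadamard :: "real mat \<Rightarrow> real mat \<Rightarrow> real mat" where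
  "hadamard X Y = mat (dim_row X) (dim_col X) (\<lambda>(i, j). X $$ (i, j) * Y $$ (i, j))"

definition ones_vec :: "nat \<Rightarrow> real vec" where
  "ones_vec n = vec n (\<lambda>_. 1)"

definition ones_mat :: "nat \<Rightarrow> real mat" where
  "ones_mat n = mat n n (\<lambda>_. 1)"

definition feasible :: "nat \<Rightarrow> real mat \<Rightarrow> bool" where
  "feasible n Q \<longleftrightarrow> Q \<in> carrier_mat n 2 \<and> (\<forall>i<n. l2_norm (row Q i) = 1)"

(* Second-order critical points of: maximise Tr(Q^T M Q) over the feasible Q, M symmetric. *)
definition second_order_critical :: "nat \<Rightarrow> real mat \<Rightarrow> real mat \<Rightarrow> bool" where
  "second_order_critical n M Q \<longleftrightarrow> feasible n Q \<and>
     (ddiag (M * (Q * Q\<^sup>T)) - M) * Q = 0\<^sub>m n 2 \<and>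
     psd n (ddiag (M * (Q * Q\<^sup>T)) - hadamard M (Q * Q\<^sup>T))"

definition balanced_labels :: "nat \<Rightarrow> real vec \<Rightarrow> bool" where
  "balanced_labels n g \<longleftrightarrow> g \<in> carrier_vec n \<and> (\<forall>i<n. g $ i = 1 \<or> g $ i = -1) \<and>
     g \<bullet> ones_vec n = 0"

(* Law of the adjacency matrix: independent Bernoulli variables indexed by the pairs i \<le> j < n,
   diagonal included, extended symmetrically.  bernoulli_pmf clamps its parameter to [0,1], so
   the law is the intended one whenever p and q are probabilities. *)
definition sbm_pmf :: "nat \<Rightarrow> real vec \<Rightarrow> real \<Rightarrow> real \<Rightarrow> real mat pmf" where
  "sbm_pmf n g p q =
     map_pmf (\<lambda>E. mat n n (\<lambda>(i, j). of_bool (E (min i j, max i j))))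
       (Pi_pmf {(i, j). i \<le> j \<and> j < n} False
          (\<lambda>(i, j). bernoulli_pmf (if g $ i * g $ j = 1 then p else q)))"

definition centered :: "nat \<Rightarrow> real \<Rightarrow> real \<Rightarrow> real mat \<Rightarrow> real mat" where
  "centered n p q A = A - ((p + q) / 2) \<cdot>\<^sub>m ones_mat n"

definition snr :: "real \<Rightarrow> real \<Rightarrow> real" where
  "snr a b = (a - b) / sqrt (2 * (a + b))"

end

theory Submission
  imports Defs "HOL-Real_Asymp.Real_Asymp"
begin

text \<open>Testing the second-order condition with \<open>Q Q\<^sup>T \<circ> g g\<^sup>T\<close> and identifying row \<open>i\<close> of \<open>Q\<close> with a unit
  complex number \<open>z\<^sub>i\<close>, the signal \<open>(p - q) / 2 \<cdot> |Q\<^sup>T g|\<^sup>2\<close> is at least \<open>(p - q) / 2 \<cdot> n\<^sup>2 / 2\<close> minus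
  noise. Since \<open>X\<^sub>i\<^sub>j\<^sup>2 = (1 + Re (z\<^sub>i\<^sup>2 cnj z\<^sub>j\<^sup>2)) / 2\<close> for \<open>X = Q Q\<^sup>T\<close>, the noise consists of the
  form \<open>\<Phi>(z) = \<Sum>\<^sub>i\<^sub>\<noteq>\<^sub>j W\<^sub>i\<^sub>j Re (z\<^sub>i cnj z\<^sub>j)\<close> at \<open>z\<close>, half of it at \<open>g z\<^sup>2\<close>, and a negligible scalar, with
  \<open>W = A - E A\<close>. The form \<open>\<Phi>\<close> is affine in each \<open>z\<^sub>i\<close>, so up to the factor \<open>cos (pi / 8)\<^sup>-\<^sup>2\<close> it is maximal
  at vertices of an octagon; a Chernoff bound and a union bound over the \<open>8\<^sup>n\<close> vertices give
  \<open>|\<Phi>| \<le> 2.21 / cos (pi / 8)\<^sup>2 \<cdot> n \<surd>a\<close>. The variance of \<open>\<Phi>(z)\<close> grows with \<open>|\<Sum> z\<^sub>i\<^sup>2|\<close>, but in the union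
  bound this growth is exactly compensated by the number of such \<open>z\<close>. As \<open>3/2 \<cdot> 2.21 / cos (pi / 8)\<^sup>2 < 4\<close>,
  the signal survives when the signal-to-noise ratio exceeds 8.\<close>

section \<open>Chernoff bounds\<close>

lemma exp_le_quadratic:
  fixes s C :: real
  assumes "\<bar>s\<bar> \<le> C"
  shows "exp s - 1 - s \<le> s\<^sup>2 / 2 * exp C"
proof -
  obtain t where t: "\<bar>t\<bar> \<le> \<bar>s\<bar>" "exp s = (\<Sum>m<2. s ^ m / fact m) + exp t / fact 2 * s ^ 2"
    using Maclaurin_exp_le[of s 2] by blast
  have "exp s - 1 - s = s\<^sup>2 / 2 * exp t"
    using t(2) by (simp add: numeral_2_eq_2)
  also have "\<dots> \<le> s\<^sup>2 / 2 * exp C"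
    using t(1) assms by (intro mult_left_mono) auto
  finally show ?thesis .
qed

text \<open>\<open>cosh\<close> is the moment generating function of a random sign, so Hoeffding's
  lemma for a fair coin applies, with step \<open>2 * y\<close> and success probability 1/2.\<close>

lemma cosh_le_exp_square:
  fixes x :: real
  shows "cosh x \<le> exp (x\<^sup>2 / 2)"
proof -
  have nonneg: "cosh y \<le> exp (y\<^sup>2 / 2)" if "0 \<le> y" for y :: real
  proof -
    let ?E = "1 + 1 / 2 * (exp (2 * y) - 1)"
    have "?E = (1 + exp (2 * y)) / 2"
      by (simp add: field_simps)
    also have "\<dots> > 0"
      by (intro divide_pos_pos add_pos_pos) auto
    finally have pos: "?E > 0" .
    have "cosh y = exp (- y) * ?E"
      by (simp add: cosh_field_def field_simps flip: exp_add)
    also have "\<dots> = exp (- y + ln ?E)"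
      using pos by (subst exp_add) simp
    also have "\<dots> \<le> exp (y\<^sup>2 / 2)"
      using Hoeffdings_lemma_aux[of "2 * y" "1 / 2"] that by (simp add: power_mult_distrib)
    finally show ?thesis .
  qed
  show ?thesis
    using nonneg[of x] nonneg[of "- x"] by (cases "0 \<le> x") auto
qed

text \<open>The exponent keeps the variance scale \<open>p\<close>, later of order 1/n, which a
  Hoeffding bound would lose. The price is the factor \<open>exp C\<close> from the quadratic
  remainder, close to 1 for small \<open>C\<close>.\<close>

lemma bernoulli_mgf_le:
  fixes p s C :: real
  assumes "0 \<le> p" "p \<le> 1" "\<bar>s\<bar> \<le> C"
  shows "measure_pmf.expectation (bernoulli_pmf p) (\<lambda>x. exp (s * (of_bool x - p)))
    \<le> exp (p * s\<^sup>2 / 2 * exp C)"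
proof -
  have "measure_pmf.expectation (bernoulli_pmf p) (\<lambda>x. exp (s * (of_bool x - p)))
      = p * exp (s * (1 - p)) + (1 - p) * exp (s * (0 - p))"
    using assms by simp
  also have "\<dots> = exp (- (s * p)) * (1 + p * (exp s - 1))"
    by (simp add: algebra_simps flip: exp_add)
  also have "\<dots> \<le> exp (- (s * p)) * exp (p * (exp s - 1))"
    by (intro mult_left_mono exp_ge_add_one_self) auto
  also have "\<dots> = exp (p * (exp s - 1 - s))"
    by (simp add: algebra_simps flip: exp_add)
  also have "\<dots> \<le> exp (p * (s\<^sup>2 / 2 * exp C))"
    using exp_le_quadratic[OF assms(3)] assms(1) by (subst exp_le_cancel_iff) (rule mult_left_mono)
  finally show ?thesis by (simp add: mult.assoc)
qed

text \<open>Markov's inequality for the exponential of the sum. The Chernoff parameter is absorbed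
  into the weights \<open>c\<close>, so \<open>u\<close> carries no factor.\<close>

lemma chernoff_Pi_bernoulli:
  fixes p c :: "'a \<Rightarrow> real" and C u :: real
  assumes fin: "finite I" and p: "\<And>e. e \<in> I \<Longrightarrow> 0 \<le> p e \<and> p e \<le> 1"
    and c: "\<And>e. e \<in> I \<Longrightarrow> \<bar>c e\<bar> \<le> C"
  shows "measure_pmf.prob (Pi_pmf I False (\<lambda>e. bernoulli_pmf (p e)))
      {E. u \<le> (\<Sum>e\<in>I. c e * (of_bool (E e) - p e))}
    \<le> exp ((\<Sum>e\<in>I. p e * (c e)\<^sup>2) / 2 * exp C - u)"
proof -
  let ?M = "Pi_pmf I False (\<lambda>e. bernoulli_pmf (p e))"
  let ?f = "\<lambda>E. \<Prod>e\<in>I. exp (c e * (of_bool (E e) - p e))"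
  have finM: "finite (set_pmf ?M)"
    by (rule finite_subset[OF set_Pi_pmf_subset'[OF fin]])
       (use fin in \<open>auto intro!: finite_PiE_dflt intro: finite_subset[OF subset_UNIV]\<close>)
  have f: "?f E = exp (\<Sum>e\<in>I. c e * (of_bool (E e) - p e))" for E
    using fin by (simp add: exp_sum)
  have "measure_pmf.prob ?M {E. u \<le> (\<Sum>e\<in>I. c e * (of_bool (E e) - p e))}
      = measure_pmf.prob ?M {E \<in> space ?M. exp u \<le> ?f E}"
    unfolding f by simp
  also have "\<dots> \<le> measure_pmf.expectation ?M ?f / exp u"
    by (rule integral_Markov_inequality_measure[where A = "{}"])
       (use finM in \<open>auto intro!: integrable_measure_pmf_finite AE_pmfI prod_nonneg\<close>)
  also have "measure_pmf.expectation ?M ?f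
      = (\<Prod>e\<in>I. measure_pmf.expectation (bernoulli_pmf (p e)) (\<lambda>x. exp (c e * (of_bool x - p e))))"
    using fin by (intro expectation_prod_Pi_pmf)
      (auto intro!: integrable_measure_pmf_finite intro: finite_subset[OF subset_UNIV])
  also have "\<dots> \<le> (\<Prod>e\<in>I. exp (p e * (c e)\<^sup>2 / 2 * exp C))"
    using p c by (intro prod_mono conjI bernoulli_mgf_le integral_nonneg_AE AE_pmfI) auto
  also have "\<dots> = exp ((\<Sum>e\<in>I. p e * (c e)\<^sup>2) / 2 * exp C)"
    using fin by (simp add: exp_sum[symmetric] sum_divide_distrib sum_distrib_right)
  finally show ?thesis
    by (simp add: exp_diff divide_right_mono)
qed

text \<open>Passes from ordered pairs to the index set of \<open>sbm_pmf\<close>, one index per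
  independent entry. That set contains the diagonal, which receives the value 0.\<close>

lemma sum_offdiag_symmetric:
  fixes f :: "nat \<Rightarrow> nat \<Rightarrow> real"
  assumes sym: "\<And>i j. f i j = f j i"
  shows "(\<Sum>i<n. \<Sum>j\<in>{..<n} - {i}. f i j)
    = (\<Sum>(i, j)\<in>{(i, j). i \<le> j \<and> j < n}. if i = j then 0 else 2 * f i j)"
proof -
  let ?U = "{(i, j). i < j \<and> j < n}" and ?L = "{(i, j). j < i \<and> i < n}"
  let ?I = "{(i, j). i \<le> j \<and> j < n}"
  have finI: "finite ?I" and finU: "finite ?U" and finL: "finite ?L"
    by (rule finite_subset[of _ "{..<n} \<times> {..<n}"]; auto)+
  have "(\<Sum>i<n. \<Sum>j\<in>{..<n} - {i}. f i j) = (\<Sum>(i, j)\<in>?U \<union> ?L. f i j)"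
    by (subst sum.Sigma) (auto intro!: sum.cong)
  also have "\<dots> = (\<Sum>(i, j)\<in>?U. f i j) + (\<Sum>(i, j)\<in>?L. f i j)"
    by (rule sum.union_disjoint[OF finU finL]) auto
  also have "(\<Sum>(i, j)\<in>?L. f i j) = (\<Sum>(i, j)\<in>?U. f i j)"
    by (rule sum.reindex_bij_witness[where i = prod.swap and j = prod.swap]) (auto simp: sym)
  also have "(\<Sum>(i, j)\<in>?U. f i j) + (\<Sum>(i, j)\<in>?U. f i j) = (\<Sum>(i, j)\<in>?U. 2 * f i j)"
    by (simp add: sum.distrib[symmetric] case_prod_unfold)
  also have "\<dots> = (\<Sum>(i, j)\<in>?I. if i = j then 0 else 2 * f i j)"
    by (rule sum.mono_neutral_cong_left[OF finI]) (auto split: if_splits)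
  finally show ?thesis .
qed

text \<open>Without the diagonal the form at \<open>x i j = Re (z i * cnj (z j))\<close> is affine
  in each \<open>z i\<close>. The matrix to which it is finally applied vanishes on the
  diagonal.\<close>

definition offdiag_form :: "nat \<Rightarrow> (nat \<Rightarrow> nat \<Rightarrow> real) \<Rightarrow> (nat \<Rightarrow> nat \<Rightarrow> real) \<Rightarrow> real" where
  "offdiag_form n w x = (\<Sum>i<n. \<Sum>j\<in>{..<n} - {i}. w i j * x i j)"

text \<open>The full mean is subtracted here, but only \<open>(p + q) / 2\<close> in
  \<open>centered\<close>; the difference is the signal \<open>(p - q) / 2\<close> times g
  g^T.\<close>

definition sbm_noise :: "real vec \<Rightarrow> real \<Rightarrow> real \<Rightarrow> real mat \<Rightarrow> nat \<Rightarrow> nat \<Rightarrow> real" where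
  "sbm_noise g p q A i j = A $$ (i, j) - (if g $ i * g $ j = 1 then p else q)"

text \<open>A pair i < j enters the form twice, so its Chernoff weight is
  \<open>2 * t * x i j\<close>; this produces \<open>exp (2 * t)\<close>. All variances are bounded
  through \<open>p\<close>, and the diagonal squares are added at the end to complete the double
  sum.\<close>

lemma chernoff_sbm:
  fixes x :: "nat \<Rightarrow> nat \<Rightarrow> real" and p q t u :: real
  assumes pq: "0 \<le> q" "q \<le> p" "p \<le> 1" and t: "0 \<le> t"
    and sym: "\<And>i j. x i j = x j i" and bd: "\<And>i j. i < n \<Longrightarrow> j < n \<Longrightarrow> \<bar>x i j\<bar> \<le> 1"
  shows "measure_pmf.prob (sbm_pmf n g p q) {A. u \<le> offdiag_form n (sbm_noise g p q A) x}
    \<le> exp (t\<^sup>2 * exp (2 * t) * p * (\<Sum>i<n. \<Sum>j<n. (x i j)\<^sup>2) - t * u)"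
proof -
  let ?I = "{(i, j). i \<le> j \<and> j < n}"
  let ?p = "\<lambda>(i, j). if g $ i * g $ j = 1 then p else q"
  let ?P = "Pi_pmf ?I False (\<lambda>e. bernoulli_pmf (?p e))"
  let ?c = "\<lambda>(i, j). if i = j then 0 else 2 * t * x i j"
  let ?adj = "\<lambda>E. mat n n (\<lambda>(i, j). of_bool (E (min i j, max i j))) :: real mat"
  have finI: "finite ?I"
    by (rule finite_subset[of _ "{..<n} \<times> {..<n}"]) auto
  have form: "t * offdiag_form n (sbm_noise g p q (?adj E)) x
      = (\<Sum>e\<in>?I. ?c e * (of_bool (E e) - ?p e))" for E
  proof -
    let ?f = "\<lambda>i j. t * ((of_bool (E (min i j, max i j)) - ?p (i, j)) * x i j)"
    have "t * offdiag_form n (sbm_noise g p q (?adj E)) x = (\<Sum>i<n. \<Sum>j\<in>{..<n} - {i}. ?f i j)"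
      by (simp add: offdiag_form_def sbm_noise_def sum_distrib_left)
    also have "\<dots> = (\<Sum>(i, j)\<in>?I. if i = j then 0 else 2 * ?f i j)"
      by (rule sum_offdiag_symmetric) (simp add: sym[of _ _] min.commute max.commute mult.commute)
    also have "\<dots> = (\<Sum>e\<in>?I. ?c e * (of_bool (E e) - ?p e))"
      by (rule sum.cong) (auto simp: algebra_simps min_def max_def)
    finally show ?thesis .
  qed
  have "measure_pmf.prob (sbm_pmf n g p q) {A. u \<le> offdiag_form n (sbm_noise g p q A) x}
      = measure_pmf.prob ?P {E. u \<le> offdiag_form n (sbm_noise g p q (?adj E)) x}"
    unfolding sbm_pmf_def by (simp add: vimage_def case_prod_unfold)
  also have "\<dots> \<le> measure_pmf.prob ?P {E. t * u \<le> (\<Sum>e\<in>?I. ?c e * (of_bool (E e) - ?p e))}"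
    unfolding form[symmetric] using t by (intro measure_pmf.finite_measure_mono) (auto intro: mult_left_mono)
  also have "\<dots> \<le> exp ((\<Sum>e\<in>?I. ?p e * (?c e)\<^sup>2) / 2 * exp (2 * t) - t * u)"
  proof (rule chernoff_Pi_bernoulli[OF finI])
    fix e assume "e \<in> ?I"
    show "\<bar>?c e\<bar> \<le> 2 * t"
      using \<open>e \<in> ?I\<close> t mult_left_mono[OF bd, of _ _ "2 * t"] by (auto simp: abs_mult)
  qed (use pq in auto)
  also have "\<dots> \<le> exp (t\<^sup>2 * exp (2 * t) * p * (\<Sum>i<n. \<Sum>j<n. (x i j)\<^sup>2) - t * u)"
  proof -
    have "(\<Sum>e\<in>?I. ?p e * (?c e)\<^sup>2) \<le> (\<Sum>(i, j)\<in>?I. if i = j then 0 else 2 * (2 * t\<^sup>2 * p * (x i j)\<^sup>2))"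
      using pq by (intro sum_mono) (auto simp: power_mult_distrib mult.left_commute[of "t\<^sup>2" p] intro!: mult_right_mono)
    also have "\<dots> = (\<Sum>i<n. \<Sum>j\<in>{..<n} - {i}. 2 * t\<^sup>2 * p * (x i j)\<^sup>2)"
      by (rule sum_offdiag_symmetric[symmetric]) (simp add: sym)
    also have "\<dots> \<le> (\<Sum>i<n. \<Sum>j<n. 2 * t\<^sup>2 * p * (x i j)\<^sup>2)"
      using pq by (intro sum_mono sum_mono2) auto
    also have "\<dots> = 2 * t\<^sup>2 * p * (\<Sum>i<n. \<Sum>j<n. (x i j)\<^sup>2)"
      by (simp add: sum_distrib_left)
    finally have "(\<Sum>e\<in>?I. ?p e * (?c e)\<^sup>2) / 2 * exp (2 * t)
        \<le> (2 * t\<^sup>2 * p * (\<Sum>i<n. \<Sum>j<n. (x i j)\<^sup>2)) / 2 * exp (2 * t)"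
      by (intro mult_right_mono divide_right_mono) auto
    then show ?thesis by (simp add: mult_ac)
  qed
  finally show ?thesis .
qed

section \<open>Reduction to the octagon\<close>

text \<open>Rounding \<open>Arg h\<close> to the nearest multiple of pi/4 changes the angle by at
  most pi/8.\<close>

lemma cis_octagon_support:
  fixes h :: complex
  shows "\<exists>k<8. cos (pi / 8) * cmod h \<le> Re (cis (real k * (pi / 4)) * cnj h)"
proof -
  define \<theta> where "\<theta> = Arg h"
  define l where "l = round (\<theta> / (pi / 4))"
  define k where "k = nat (l mod 8)"
  have l: "\<bar>\<theta> - of_int l * (pi / 4)\<bar> \<le> pi / 8"
  proof -
    have "\<theta> - of_int l * (pi / 4) = (\<theta> / (pi / 4) - of_int l) * (pi / 4)"
      by (simp add: algebra_simps)
    also have "\<bar>\<dots>\<bar> = \<bar>of_int l - \<theta> / (pi / 4)\<bar> * (pi / 4)"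
      by (simp add: abs_mult abs_minus_commute)
    also have "\<dots> \<le> 1 / 2 * (pi / 4)"
      using of_int_round_abs_le[of "\<theta> / (pi / 4)"] unfolding l_def
      by (intro mult_right_mono) auto
    finally show ?thesis by simp
  qed
  have "k < 8" by (simp add: k_def nat_less_iff)
  have k: "cis (real k * (pi / 4)) = cis (of_int l * (pi / 4))"
  proof -
    have "of_int l = real_of_int (l div 8) * 8 + real_of_int (l mod 8)"
      by (metis div_mult_mod_eq of_int_add of_int_mult of_int_numeral)
    moreover have "real k = real_of_int (l mod 8)"
      by (simp add: k_def)
    ultimately have "of_int l * (pi / 4) = 2 * pi * real_of_int (l div 8) + real k * (pi / 4)"
      by (simp add: algebra_simps)
    then show ?thesis
      by (simp only: cis_mult[symmetric]) (simp add: cis_multiple_2pi)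
  qed
  have h: "h = of_real (cmod h) * cis \<theta>"
    by (metis \<theta>_def rcis_cmod_Arg rcis_def)
  have "cos (pi / 8) \<le> cos \<bar>\<theta> - of_int l * (pi / 4)\<bar>"
    using l by (intro cos_monotone_0_pi_le) auto
  also have "\<dots> = cos (of_int l * (pi / 4) - \<theta>)"
    by (metis cos_abs_real cos_minus minus_diff_eq)
  finally have "cos (pi / 8) * cmod h \<le> cos (of_int l * (pi / 4) - \<theta>) * cmod h"
    by (rule mult_right_mono) simp
  also have "\<dots> = Re (cis (real k * (pi / 4)) * cnj (of_real (cmod h) * cis \<theta>))"
    unfolding k by (simp add: cos_diff algebra_simps)
  finally show ?thesis
    using \<open>k < 8\<close> h by metis
qed

text \<open>Coordinate \<open>m\<close> enters through row and column \<open>m\<close>, which agree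
  by symmetry, hence the factor 2. There is no diagonal term that could be quadratic in
  \<open>x\<close>.\<close>

lemma offdiag_form_split:
  assumes sym: "\<And>i j. i < n \<Longrightarrow> j < n \<Longrightarrow> w i j = w j i" and "m < n"
  shows "\<exists>r. \<forall>x. offdiag_form n w (\<lambda>i j. Re ((q(m := x)) i * cnj ((q(m := x)) j)))
    = r + Re (x * cnj (2 * (\<Sum>j\<in>{..<n} - {m}. of_real (w m j) * q j)))"
proof -
  let ?T = "{..<n} - {m}"
  let ?g = "\<lambda>q i j. w i j * Re (q i * cnj (q j))"
  let ?h = "\<Sum>j\<in>?T. of_real (w m j) * q j"
  have ins: "{..<n} = insert m ?T"
    using assms by auto
  have "offdiag_form n w (\<lambda>i j. Re ((q(m := x)) i * cnj ((q(m := x)) j)))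
     = (\<Sum>i\<in>?T. \<Sum>j\<in>?T - {i}. ?g q i j) + Re (x * cnj (2 * ?h))" (is "?L = _") for x
  proof -
    have "?L = (\<Sum>j\<in>?T. ?g (q(m := x)) m j) + (\<Sum>i\<in>?T. \<Sum>j\<in>{..<n} - {i}. ?g (q(m := x)) i j)"
      unfolding offdiag_form_def by (subst ins, subst sum.insert) auto
    also have "(\<Sum>i\<in>?T. \<Sum>j\<in>{..<n} - {i}. ?g (q(m := x)) i j)
        = (\<Sum>i\<in>?T. ?g (q(m := x)) i m + (\<Sum>j\<in>?T - {i}. ?g q i j))"
    proof (rule sum.cong)
      fix i assume i: "i \<in> ?T"
      then have "{..<n} - {i} = insert m (?T - {i})"
        using assms by auto
      then show "(\<Sum>j\<in>{..<n} - {i}. ?g (q(m := x)) i j)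
          = ?g (q(m := x)) i m + (\<Sum>j\<in>?T - {i}. ?g q i j)"
        using i by simp
    qed simp
    also have "\<dots> = (\<Sum>i\<in>?T. ?g (q(m := x)) i m) + (\<Sum>i\<in>?T. \<Sum>j\<in>?T - {i}. ?g q i j)"
      by (rule sum.distrib)
    also have "(\<Sum>i\<in>?T. ?g (q(m := x)) i m) = (\<Sum>i\<in>?T. ?g (q(m := x)) m i)"
      using assms by (intro sum.cong refl) (auto simp: mult_ac)
    also have "\<dots> = Re (x * cnj ?h)"
      by (simp add: sum_distrib_left algebra_simps)
    finally show ?thesis by simp
  qed
  then show ?thesis by blast
qed

text \<open>The form is affine in each \<open>q i\<close> separately, so the \<open>q i\<close> can be moved one at a
  time from the unit disc to a vertex of the circumscribed octagon.\<close>

lemma offdiag_form_le_octagon: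
  fixes q :: "nat \<Rightarrow> complex"
  assumes sym: "\<And>i j. i < n \<Longrightarrow> j < n \<Longrightarrow> w i j = w j i"
    and vertex: "\<And>k. k \<in> {..<n} \<rightarrow>\<^sub>E {..<8::nat} \<Longrightarrow>
      offdiag_form n w (\<lambda>i j. Re (cis (real (k i) * (pi / 4)) * cnj (cis (real (k j) * (pi / 4))))) \<le> U"
    and unit: "\<And>i. i < n \<Longrightarrow> cmod (q i) \<le> 1"
  shows "offdiag_form n w (\<lambda>i j. Re (q i * cnj (q j))) \<le> U / (cos (pi / 8))\<^sup>2"
proof -
  let ?c = "cos (pi / 8)"
  \<comment> \<open>Vertices of the octagon circumscribed about the unit circle; each of the two
    arguments of the form contributes one factor \<open>1 / ?c\<close>.\<close>
  let ?v = "\<lambda>k::nat. cis (real k * (pi / 4)) / of_real ?c"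
  have c: "?c > 0"
    by (rule cos_gt_zero) auto
  have "m \<le> n \<Longrightarrow> (\<And>i. i < m \<Longrightarrow> \<exists>k<8. q i = ?v k) \<Longrightarrow> (\<And>i. m \<le> i \<Longrightarrow> i < n \<Longrightarrow> cmod (q i) \<le> 1) \<Longrightarrow>
      offdiag_form n w (\<lambda>i j. Re (q i * cnj (q j))) \<le> U / ?c\<^sup>2" for m
  \<comment> \<open>Induction on the number of coordinates still in the disc; those below
    \<open>m\<close> are vertices already.\<close>
  proof (induction "n - m" arbitrary: m q)
    case 0
    then have "\<forall>i\<in>{..<n}. \<exists>k<8. q i = ?v k" by auto
    then obtain k where k: "\<And>i. i < n \<Longrightarrow> k i < 8 \<and> q i = ?v (k i)"
      by (metis lessThan_iff)
    let ?k = "restrict k {..<n}"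
    have scale: "Re (x / of_real ?c * cnj (y / of_real ?c)) = Re (x * cnj y) / ?c\<^sup>2" for x y
    proof -
      have "x / of_real ?c * cnj (y / of_real ?c) = x * cnj y / of_real (?c\<^sup>2)"
        by (simp add: power2_eq_square)
      then show ?thesis by (simp only: Re_divide_of_real)
    qed
    have "offdiag_form n w (\<lambda>i j. Re (q i * cnj (q j)))
        = offdiag_form n w (\<lambda>i j. Re (cis (real (?k i) * (pi / 4)) * cnj (cis (real (?k j) * (pi / 4))))) / ?c\<^sup>2"
      unfolding offdiag_form_def sum_divide_distrib
    proof (intro sum.cong refl)
      fix i j assume "i \<in> {..<n}" "j \<in> {..<n} - {i}"
      then have "q i = ?v (?k i)" "q j = ?v (?k j)"
        using k by auto
      then show "w i j * Re (q i * cnj (q j))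
          = w i j * Re (cis (real (?k i) * (pi / 4)) * cnj (cis (real (?k j) * (pi / 4)))) / ?c\<^sup>2"
        by (simp only: scale times_divide_eq_right)
    qed
    also have "\<dots> \<le> U / ?c\<^sup>2"
      using k by (intro divide_right_mono vertex restrict_PiE_iff[THEN iffD2]) auto
    finally show ?case .
  next
    case (Suc d)
    then have mn: "m < n" by simp
    obtain r where r: "\<And>x. offdiag_form n w (\<lambda>i j. Re ((q(m := x)) i * cnj ((q(m := x)) j)))
        = r + Re (x * cnj (2 * (\<Sum>j\<in>{..<n} - {m}. of_real (w m j) * q j)))" (is "\<And>x. _ = r + Re (x * cnj ?h)")
      using offdiag_form_split[of n w m q] sym mn by blast
    obtain k where k: "k < 8" "?c * cmod ?h \<le> Re (cis (real k * (pi / 4)) * cnj ?h)"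
      using cis_octagon_support by blast
    have "offdiag_form n w (\<lambda>i j. Re (q i * cnj (q j))) = r + Re (q m * cnj ?h)"
      using r[of "q m"] by simp
    also have "Re (q m * cnj ?h) \<le> cmod (q m) * cmod ?h"
      by (metis complex_Re_le_cmod complex_mod_cnj norm_mult)
    also have "\<dots> \<le> 1 * cmod ?h"
      using Suc.prems(3)[of m] mn by (intro mult_right_mono) auto
    \<comment> \<open>The division by \<open>?c\<close> in the vertex makes up for the loss in
      \<open>cis_octagon_support\<close>, so moving \<open>q m\<close> does not decrease the
      form.\<close>
    also have "\<dots> \<le> Re (?v k * cnj ?h)"
      using k(2) c by (simp add: field_simps)
    also have "r + Re (?v k * cnj ?h)
        = offdiag_form n w (\<lambda>i j. Re ((q(m := ?v k)) i * cnj ((q(m := ?v k)) j)))"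
      by (rule r[symmetric])
    also have "\<dots> \<le> U / ?c\<^sup>2"
    proof (rule Suc.hyps(1)[of "Suc m"])
      show "\<exists>l<8. (q(m := ?v k)) i = ?v l" if "i < Suc m" for i
        using that k(1) Suc.prems(2)[of i] by (cases "i = m") auto
    qed (use Suc.hyps(2) Suc.prems mn in auto)
    finally show ?case by simp
  qed
  from this[of 0] unit show ?thesis by simp
qed

text \<open>The half-angle formula for the squared cosine of the angle between \<open>x\<close> and
  \<open>y\<close>.\<close>

lemma Re_mult_cnj_square:
  assumes "cmod x = 1" "cmod y = 1"
  shows "(Re (x * cnj y))\<^sup>2 = (1 + Re (x\<^sup>2 * cnj (y\<^sup>2))) / 2"
proof -
  let ?z = "x * cnj y"
  have "cmod ?z = 1" using assms by (simp add: norm_mult)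
  then have "(Re ?z)\<^sup>2 + (Im ?z)\<^sup>2 = 1"
    by (simp add: cmod_def)
  moreover have "Re (?z\<^sup>2) = (Re ?z)\<^sup>2 - (Im ?z)\<^sup>2"
    by (simp add: power2_eq_square)
  moreover have "x\<^sup>2 * cnj (y\<^sup>2) = ?z\<^sup>2"
    by (simp add: power_mult_distrib)
  moreover have "a + b = 1 \<Longrightarrow> a = (1 + (a - b)) / 2" for a b :: real
    by (simp add: field_simps)
  ultimately show ?thesis by metis
qed

lemma sum_Re_mult_cnj:
  "(\<Sum>i\<in>I. \<Sum>j\<in>I. Re (z i * cnj (z j))) = (cmod (\<Sum>i\<in>I. z i))\<^sup>2"
proof -
  have "(\<Sum>i\<in>I. \<Sum>j\<in>I. Re (z i * cnj (z j))) = Re ((\<Sum>i\<in>I. z i) * cnj (\<Sum>i\<in>I. z i))"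
    by (simp only: cnj_sum sum_product Re_sum)
  also have "\<dots> = (cmod (\<Sum>i\<in>I. z i))\<^sup>2"
    by (metis Re_complex_of_real complex_norm_square)
  finally show ?thesis .
qed

text \<open>Serves twice: as the variance of the form in the union bound, and as the lower bound
  n^2/2 in the signal.\<close>

lemma sum_Re_mult_cnj_square:
  assumes "\<And>i. i < n \<Longrightarrow> cmod (z i) = 1"
  shows "(\<Sum>i<n. \<Sum>j<n. (Re (z i * cnj (z j)))\<^sup>2) = ((real n)\<^sup>2 + (cmod (\<Sum>i<n. (z i)\<^sup>2))\<^sup>2) / 2"
proof -
  have "(\<Sum>i<n. \<Sum>j<n. (Re (z i * cnj (z j)))\<^sup>2)
      = (\<Sum>i<n. \<Sum>j<n. (1 + Re ((z i)\<^sup>2 * cnj ((z j)\<^sup>2))) / 2)"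
    using assms by (intro sum.cong refl Re_mult_cnj_square) auto
  also have "\<dots> = (\<Sum>i<n. \<Sum>j<n. 1 + Re ((z i)\<^sup>2 * cnj ((z j)\<^sup>2))) / 2"
    by (simp only: sum_divide_distrib)
  also have "\<dots> = ((real n)\<^sup>2 + (cmod (\<Sum>i<n. (z i)\<^sup>2))\<^sup>2) / 2"
    by (simp only: sum.distrib sum_Re_mult_cnj) (simp add: power2_eq_square)
  finally show ?thesis .
qed

section \<open>Union bound\<close>

text \<open>The powers run twice through the fourth roots of unity, and the resulting 4 (cosh 2a +
  cosh 2b) factors into a product of two \<open>cosh\<close>.\<close>

lemma sum_exp_i_power_le:
  fixes a b :: real
  shows "(\<Sum>k<8. exp (2 * (Re (\<i> ^ k) * a + Im (\<i> ^ k) * b))) \<le> 8 * exp (a\<^sup>2 + b\<^sup>2)"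
proof -
  have "(\<Sum>k<8. exp (2 * (Re (\<i> ^ k) * a + Im (\<i> ^ k) * b))) = 8 * (cosh (a + b) * cosh (a - b))"
    by (simp add: eval_nat_numeral cosh_field_def algebra_simps flip: exp_add)
  also have "\<dots> \<le> 8 * (exp ((a + b)\<^sup>2 / 2) * exp ((a - b)\<^sup>2 / 2))"
    by (intro mult_left_mono mult_mono cosh_le_exp_square) auto
  also have "\<dots> = 8 * exp (a\<^sup>2 + b\<^sup>2)"
    by (simp add: power2_eq_square field_simps flip: exp_add)
  finally show ?thesis .
qed

text \<open>Since \<open>w = \<Sum> z\<^sub>i\<^sup>2\<close> is a Gaussian integer \<open>v\<close> in the square \<open>|Re v|, |Im v| \<le> n\<close>, the quadratic
  exponent is linearised by \<open>exp (|w|\<^sup>2 / n) \<le> \<Sum>\<^sub>v exp ((2 Re (w cnj v) - |v|\<^sup>2) / n)\<close>.\<close>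

lemma sum_octagon_exp_le:
  assumes "n > 0"
  shows "(\<Sum>k\<in>{..<n} \<rightarrow>\<^sub>E {..<8::nat}. exp ((cmod (\<Sum>i<n. (cis (real (k i) * (pi / 4)))\<^sup>2))\<^sup>2 / real n))
    \<le> (2 * real n + 1)\<^sup>2 * 8 ^ n"
proof -
  let ?K = "{..<n} \<rightarrow>\<^sub>E {..<8::nat}"
  let ?w = "\<lambda>k. \<Sum>i<n. \<i> ^ k i"
  let ?V = "{- int n..int n} \<times> {- int n..int n}"
  let ?N = "real n"
  let ?e = "\<lambda>w a b. exp ((2 * (Re w * real_of_int a + Im w * real_of_int b)
      - ((real_of_int a)\<^sup>2 + (real_of_int b)\<^sup>2)) / ?N)"
  \<comment> \<open>Squaring doubles the angle, so squared vertices are powers of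
    \<open>\<i>\<close> and their sum is a Gaussian integer.\<close>
  have square: "(cis (real l * (pi / 4)))\<^sup>2 = \<i> ^ l" for l
  proof -
    have "(cis (real l * (pi / 4)))\<^sup>2 = cis (real l * (pi / 2))"
      by (simp add: Complex.DeMoivre mult.commute)
    also have "\<dots> = \<i> ^ l"
      by (simp only: Complex.DeMoivre[symmetric] cis_pi_half)
    finally show ?thesis .
  qed
  have component: "\<exists>a\<in>{- int n..int n}. r = real_of_int a"
    if r: "r \<in> \<int>" "\<bar>r\<bar> \<le> ?N" for r
  proof -
    obtain a where "r = real_of_int a"
      using r(1) by (rule Ints_cases)
    moreover from this have "\<bar>a\<bar> \<le> int n"
      using r(2) by linarith
    ultimately show ?thesis
      by (intro bexI[of _ a]) auto
  qed
  have unit: "Re (\<i> ^ l) \<in> \<int>" "Im (\<i> ^ l) \<in> \<int>" for l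
    by (induction l) auto
  have pointwise: "exp ((cmod (?w k))\<^sup>2 / ?N) \<le> (\<Sum>(a, b)\<in>?V. ?e (?w k) a b)" for k
  proof -
    have bound: "cmod (?w k) \<le> ?N"
      using norm_sum[of "\<lambda>i. \<i> ^ k i" "{..<n}"] by (simp add: norm_power)
    obtain a where a: "a \<in> {- int n..int n}" "Re (?w k) = real_of_int a"
      using component[of "Re (?w k)"] unit abs_Re_le_cmod[of "?w k"] bound
      by (fastforce intro: Ints_sum)
    obtain b where b: "b \<in> {- int n..int n}" "Im (?w k) = real_of_int b"
      using component[of "Im (?w k)"] unit abs_Im_le_cmod[of "?w k"] bound
      by (fastforce intro: Ints_sum)
    \<comment> \<open>At v = w the linearised exponent equals |w|^2/n, so the left side is one term
      of a positive sum.\<close>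
    have "exp ((cmod (?w k))\<^sup>2 / ?N) = ?e (?w k) a b"
      unfolding cmod_power2 a(2) b(2) by (simp add: power2_eq_square)
    also have "\<dots> = (case (a, b) of (a, b) \<Rightarrow> ?e (?w k) a b)"
      by simp
    also have "\<dots> \<le> (\<Sum>(a, b)\<in>?V. ?e (?w k) a b)"
      by (rule member_le_sum) (use a b in auto)
    finally show ?thesis .
  qed
  \<comment> \<open>For fixed v the exponent is additive over the coordinates, so the sum over
    \<open>k\<close> factorises. The n factors together give exp (|v|^2/n), which cancels
    \<open>exp (- ?r)\<close>.\<close>
  have fixed: "(\<Sum>k\<in>?K. ?e (?w k) a b) \<le> 8 ^ n" for a b
  proof -
    let ?a = "real_of_int a / ?N" and ?b = "real_of_int b / ?N"
    let ?r = "((real_of_int a)\<^sup>2 + (real_of_int b)\<^sup>2) / ?N"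
    have e: "?e (?w k) a b = exp (- ?r) * (\<Prod>i<n. exp (2 * (Re (\<i> ^ k i) * ?a + Im (\<i> ^ k i) * ?b)))" for k
      by (simp add: exp_sum[symmetric] sum_distrib_right sum_distrib_left sum.distrib
          sum_divide_distrib diff_divide_distrib add_divide_distrib algebra_simps flip: exp_add)
    have "(\<Sum>k\<in>?K. ?e (?w k) a b)
        = exp (- ?r) * (\<Prod>i<n. \<Sum>l<8. exp (2 * (Re (\<i> ^ l) * ?a + Im (\<i> ^ l) * ?b)))"
      unfolding e by (subst prod_sum_PiE) (auto simp: sum_distrib_left)
    also have "\<dots> \<le> exp (- ?r) * (\<Prod>i<n. 8 * exp (?a\<^sup>2 + ?b\<^sup>2))"
      by (intro mult_left_mono prod_mono conjI sum_exp_i_power_le sum_nonneg) auto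
    also have "\<dots> = 8 ^ n * (exp (- ?r) * exp (?N * (?a\<^sup>2 + ?b\<^sup>2)))"
      by (simp add: power_mult_distrib exp_of_nat_mult)
    also have "?N * (?a\<^sup>2 + ?b\<^sup>2) = ?r"
      using assms by (simp add: power2_eq_square field_simps)
    finally show ?thesis by (simp flip: exp_add)
  qed
  have "(\<Sum>k\<in>?K. exp ((cmod (?w k))\<^sup>2 / ?N)) \<le> (\<Sum>k\<in>?K. \<Sum>(a, b)\<in>?V. ?e (?w k) a b)"
    by (intro sum_mono pointwise)
  also have "\<dots> = (\<Sum>(a, b)\<in>?V. \<Sum>k\<in>?K. ?e (?w k) a b)"
    by (subst sum.swap) (simp add: case_prod_unfold)
  also have "\<dots> \<le> (\<Sum>(a, b)\<in>?V. 8 ^ n)"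
    using fixed by (intro sum_mono) auto
  also have "\<dots> = real (card ?V) * 8 ^ n"
    by (simp add: case_prod_unfold)
  also have "real (card ?V) = (2 * ?N + 1)\<^sup>2"
    by (simp add: card_cartesian_product power2_eq_square nat_add_distrib nat_mult_distrib algebra_simps)
  finally show ?thesis
    unfolding square .
qed

lemma sbm_noise_symmetric:
  assumes "A \<in> set_pmf (sbm_pmf n g p q)" "i < n" "j < n"
  shows "sbm_noise g p q A i j = sbm_noise g p q A j i"
  using assms by (auto simp: sbm_pmf_def sbm_noise_def min.commute max.commute mult.commute)

lemma set_sbm_pmf: "A \<in> set_pmf (sbm_pmf n g p q) \<Longrightarrow> A \<in> carrier_mat n n"
  by (auto simp: sbm_pmf_def)

lemma offdiag_form_mult:
  "offdiag_form n w (\<lambda>i j. c * x i j) = c * offdiag_form n w x"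
  by (simp add: offdiag_form_def sum_distrib_left mult_ac)

text \<open>With \<open>tp\<close> the Chernoff exponent at a vertex is at most n + |w|^2/n - t u,
  where w is the sum of the squared coordinates. By \<open>sum_octagon_exp_le\<close> the term
  |w|^2/n then costs only a polynomial factor in the union bound.\<close>

lemma prob_noise_form_gt:
  fixes p q t u :: real
  assumes pq: "0 \<le> q" "q \<le> p" "p \<le> 1" and t: "0 \<le> t" and n: "n > 0"
    and tp: "t\<^sup>2 * exp (2 * t) * p \<le> 2 / real n"
  shows "measure_pmf.prob (sbm_pmf n g p q)
      {A. \<exists>z. (\<forall>i<n. cmod (z i) = 1) \<and>
        u / (cos (pi / 8))\<^sup>2 < \<bar>offdiag_form n (sbm_noise g p q A) (\<lambda>i j. Re (z i * cnj (z j)))\<bar>}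
    \<le> 2 * (2 * real n + 1)\<^sup>2 * 8 ^ n * exp (real n - t * u)"
proof -
  let ?M = "sbm_pmf n g p q"
  let ?K = "{..<n} \<rightarrow>\<^sub>E {..<8::nat}"
  let ?c = "\<lambda>k i. cis (real (k i :: nat) * (pi / 4))"
  let ?x = "\<lambda>k i j. Re (?c k i * cnj (?c k j))"
  let ?B = "\<lambda>\<sigma> k. {A. u \<le> offdiag_form n (sbm_noise g p q A) (\<lambda>i j. \<sigma> * ?x k i j)}"
  let ?S = "{A. \<exists>z. (\<forall>i<n. cmod (z i) = 1) \<and>
        u / (cos (pi / 8))\<^sup>2 < \<bar>offdiag_form n (sbm_noise g p q A) (\<lambda>i j. Re (z i * cnj (z j)))\<bar>}"
  have fin: "finite ?K"
    by (intro finite_PiE) auto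
  \<comment> \<open>Restricted to the support, where the noise is known to be symmetric.\<close>
  have sub: "?S \<inter> set_pmf ?M \<subseteq> (\<Union>(\<sigma>, k)\<in>{1, -1} \<times> ?K. ?B \<sigma> k)"
  proof
    fix A assume "A \<in> ?S \<inter> set_pmf ?M"
    then obtain z where A: "A \<in> set_pmf ?M" and z: "\<And>i. i < n \<Longrightarrow> cmod (z i) = 1"
      and gt: "u / (cos (pi / 8))\<^sup>2 < \<bar>offdiag_form n (sbm_noise g p q A) (\<lambda>i j. Re (z i * cnj (z j)))\<bar>"
      by auto
    let ?W = "sbm_noise g p q A"
    show "A \<in> (\<Union>(\<sigma>, k)\<in>{1, -1} \<times> ?K. ?B \<sigma> k)"
    proof (rule ccontr)
      assume *: "A \<notin> (\<Union>(\<sigma>, k)\<in>{1, -1} \<times> ?K. ?B \<sigma> k)"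
      have less: "\<sigma> * offdiag_form n ?W (?x k) \<le> u" if "k \<in> ?K" "\<sigma> \<in> {1, -1}" for k \<sigma>
        using * that unfolding offdiag_form_mult by fastforce
      \<comment> \<open>The octagon reduction is one-sided, so it is applied to the noise and to its
        negative.\<close>
      have le: "offdiag_form n (\<lambda>i j. \<sigma> * ?W i j) (\<lambda>i j. Re (z i * cnj (z j))) \<le> u / (cos (pi / 8))\<^sup>2"
        if "\<sigma> \<in> {1, -1}" for \<sigma>
      proof (rule offdiag_form_le_octagon)
        show "offdiag_form n (\<lambda>i j. \<sigma> * ?W i j) (?x k) \<le> u" if "k \<in> ?K" for k
          using less[OF that \<open>\<sigma> \<in> {1, -1}\<close>] by (simp add: offdiag_form_def sum_distrib_left mult.assoc)
      qed (use z sbm_noise_symmetric[OF A] in auto)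
      from le[of 1] le[of "-1"] gt show False
        by (simp add: offdiag_form_def sum_negf)
    qed
  qed
  have each: "measure_pmf.prob ?M (?B \<sigma> k)
      \<le> exp (real n - t * u) * exp ((cmod (\<Sum>i<n. (?c k i)\<^sup>2))\<^sup>2 / real n)"
    if "\<sigma> \<in> {1, -1}" for \<sigma> k
  proof -
    have "measure_pmf.prob ?M (?B \<sigma> k)
        \<le> exp (t\<^sup>2 * exp (2 * t) * p * (\<Sum>i<n. \<Sum>j<n. (\<sigma> * ?x k i j)\<^sup>2) - t * u)"
    proof (rule chernoff_sbm[OF pq t])
      show "\<bar>\<sigma> * ?x k i j\<bar> \<le> 1" for i j
        using that abs_Re_le_cmod[of "?c k i * cnj (?c k j)"] by (auto simp: norm_mult)
    qed (simp add: mult.commute)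
    also have "(\<Sum>i<n. \<Sum>j<n. (\<sigma> * ?x k i j)\<^sup>2) = (\<Sum>i<n. \<Sum>j<n. (?x k i j)\<^sup>2)"
      using that by (auto simp: power_mult_distrib)
    also have "\<dots> = ((real n)\<^sup>2 + (cmod (\<Sum>i<n. (?c k i)\<^sup>2))\<^sup>2) / 2"
      by (rule sum_Re_mult_cnj_square) simp
    also have "exp (t\<^sup>2 * exp (2 * t) * p * (((real n)\<^sup>2 + (cmod (\<Sum>i<n. (?c k i)\<^sup>2))\<^sup>2) / 2) - t * u)
        \<le> exp (2 / real n * (((real n)\<^sup>2 + (cmod (\<Sum>i<n. (?c k i)\<^sup>2))\<^sup>2) / 2) - t * u)"
      by (subst exp_le_cancel_iff, intro diff_right_mono mult_right_mono tp) auto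
    also have "2 / real n * (((real n)\<^sup>2 + (cmod (\<Sum>i<n. (?c k i)\<^sup>2))\<^sup>2) / 2) - t * u
        = (real n - t * u) + (cmod (\<Sum>i<n. (?c k i)\<^sup>2))\<^sup>2 / real n"
      using n by (simp add: field_simps power2_eq_square)
    finally show ?thesis by (simp only: exp_add)
  qed
  have "measure_pmf.prob ?M ?S = measure_pmf.prob ?M (?S \<inter> set_pmf ?M)"
    by (simp add: measure_Int_set_pmf)
  also have "\<dots> \<le> measure_pmf.prob ?M (\<Union>(\<sigma>, k)\<in>{1, -1} \<times> ?K. ?B \<sigma> k)"
    by (intro measure_pmf.finite_measure_mono sub) auto
  also have "\<dots> \<le> (\<Sum>(\<sigma>, k)\<in>{1, -1} \<times> ?K. measure_pmf.prob ?M (?B \<sigma> k))"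
    using fin measure_pmf.finite_measure_subadditive_finite[of "{1, -1} \<times> ?K" "\<lambda>(\<sigma>, k). ?B \<sigma> k" ?M]
    by (simp add: case_prod_unfold)
  also have "\<dots> \<le> (\<Sum>(\<sigma>, k)\<in>{1::real, -1} \<times> ?K.
      exp (real n - t * u) * exp ((cmod (\<Sum>i<n. (?c k i)\<^sup>2))\<^sup>2 / real n))"
    using each by (intro sum_mono) auto
  also have "\<dots> = 2 * exp (real n - t * u) * (\<Sum>k\<in>?K. exp ((cmod (\<Sum>i<n. (?c k i)\<^sup>2))\<^sup>2 / real n))"
    by (simp add: sum.cartesian_product[symmetric] sum_distrib_left mult.assoc)
  also have "\<dots> \<le> 2 * exp (real n - t * u) * ((2 * real n + 1)\<^sup>2 * 8 ^ n)"
    by (intro mult_left_mono sum_octagon_exp_le n) auto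
  finally show ?thesis by (simp add: mult_ac)
qed

section \<open>The second-order condition\<close>

lemma balanced_labels_square:
  assumes "balanced_labels n g" "i < n"
  shows "g $ i * g $ i = 1"
  using assms by (auto simp: balanced_labels_def)

text \<open>The second-order condition is tested with the two vectors \<open>(g\<^sub>i Q\<^sub>i\<^sub>k)\<^sub>i\<close>, i.e. with
  the positive semidefinite matrix \<open>Q Q\<^sup>T \<circ> g g\<^sup>T\<close>.\<close>

lemma second_order_critical_test:
  fixes g :: "real vec"
  assumes crit: "second_order_critical n M Q" and M: "M \<in> carrier_mat n n"
    and g: "\<And>i. i < n \<Longrightarrow> g $ i * g $ i = 1"
    and x: "x = (\<lambda>i j. Q $$ (i, 0) * Q $$ (j, 0) + Q $$ (i, 1) * Q $$ (j, 1))"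
  shows "0 \<le> (\<Sum>i<n. \<Sum>j<n. M $$ (i, j) * (x i j - g $ i * g $ j * (x i j)\<^sup>2))"
proof -
  have Q: "Q \<in> carrier_mat n 2" and row: "\<And>i. i < n \<Longrightarrow> l2_norm (row Q i) = 1"
    using crit by (auto simp: second_order_critical_def feasible_def)
  have unit: "x i i = 1" if "i < n" for i
  proof -
    have "row Q i \<bullet> row Q i = x i i"
      using Q that by (simp add: x scalar_prod_def numeral_2_eq_2)
    then show ?thesis
      using row[OF that] by (simp add: l2_norm_def)
  qed
  let ?X = "Q * Q\<^sup>T"
  let ?S = "ddiag (M * ?X) - hadamard M ?X"
  have X: "?X $$ (i, j) = x i j" if "i < n" "j < n" for i j
    using Q that by (simp add: x scalar_prod_def numeral_2_eq_2)
  have sym: "x i j = x j i" for i j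
    by (simp add: x)
  have S: "?S $$ (i, j) = (if i = j then (\<Sum>l<n. M $$ (i, l) * x i l) else 0) - M $$ (i, j) * x i j"
    if ij: "i < n" "j < n" for i j
  proof -
    have "(M * ?X) $$ (i, i) = (\<Sum>l<n. M $$ (i, l) * ?X $$ (l, i))"
      using M Q ij by (auto simp: scalar_prod_def atLeast0LessThan intro!: sum.cong)
    also have "\<dots> = (\<Sum>l<n. M $$ (i, l) * x i l)"
      using ij by (intro sum.cong) (auto simp: X sym[of i] simp del: index_mult_mat)
    finally have "(M * ?X) $$ (i, i) = (\<Sum>l<n. M $$ (i, l) * x i l)" .
    then show ?thesis
      using M Q ij by (auto simp: ddiag_def hadamard_def mat_diag_def X simp del: index_mult_mat(1))
  qed
  have psd: "0 \<le> v \<bullet> (?S *\<^sub>v v)" if "v \<in> carrier_vec n" for v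
    using crit that by (simp add: second_order_critical_def psd_def)
  have Sdim: "?S \<in> carrier_mat n n"
    using crit by (simp add: second_order_critical_def psd_def)
  let ?v = "\<lambda>k. vec n (\<lambda>i. g $ i * Q $$ (i, k))"
  have test: "0 \<le> (\<Sum>i<n. \<Sum>j<n. ?S $$ (i, j) * (g $ i * g $ j * (Q $$ (i, k) * Q $$ (j, k))))" for k
  proof -
    have "0 \<le> ?v k \<bullet> (?S *\<^sub>v ?v k)"
      by (rule psd) simp
    also have "\<dots> = (\<Sum>i<n. ?v k $ i * (\<Sum>j<n. ?S $$ (i, j) * ?v k $ j))"
      using Sdim by (auto simp: scalar_prod_def atLeast0LessThan simp del: index_minus_mat intro!: sum.cong)
    also have "\<dots> = (\<Sum>i<n. \<Sum>j<n. ?S $$ (i, j) * (g $ i * g $ j * (Q $$ (i, k) * Q $$ (j, k))))"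
      by (auto simp: sum_distrib_left mult_ac intro!: sum.cong)
    finally show ?thesis .
  qed
  have "0 \<le> (\<Sum>i<n. \<Sum>j<n. ?S $$ (i, j) * (g $ i * g $ j * x i j))"
    using add_mono[OF test[of 0] test[of 1]]
    by (simp add: x distrib_left sum.distrib del: index_minus_mat)
  \<comment> \<open>On the diagonal \<open>g $ i * g $ i * x i i\<close> is 1, so the
    \<open>ddiag\<close> part contributes its full trace; the Hadamard part squares
    \<open>x\<close>.\<close>
  also have "\<dots> = (\<Sum>i<n. \<Sum>j<n. (if i = j then (\<Sum>l<n. M $$ (i, l) * x i l) else 0)
      - M $$ (i, j) * (g $ i * g $ j * (x i j)\<^sup>2))"
    using g unit by (intro sum.cong refl) (auto simp: S power2_eq_square algebra_simps simp del: index_minus_mat)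
  also have "\<dots> = (\<Sum>i<n. \<Sum>j<n. M $$ (i, j) * (x i j - g $ i * g $ j * (x i j)\<^sup>2))"
    by (simp add: sum_subtractf right_diff_distrib)
  finally show ?thesis .
qed

lemma l2_norm_transpose_mult:
  assumes Q: "Q \<in> carrier_mat n 2" and g: "g \<in> carrier_vec n"
  shows "l2_norm (Q\<^sup>T *\<^sub>v g) = cmod (\<Sum>i<n. of_real (g $ i) * Complex (Q $$ (i, 0)) (Q $$ (i, 1)))"
proof -
  have entry: "(Q\<^sup>T *\<^sub>v g) $ k = (\<Sum>i<n. g $ i * Q $$ (i, k))" if "k < 2" for k
    using assms that by (auto simp: scalar_prod_def atLeast0LessThan mult.commute intro!: sum.cong)
  have "(Q\<^sup>T *\<^sub>v g) \<bullet> (Q\<^sup>T *\<^sub>v g) = ((Q\<^sup>T *\<^sub>v g) $ 0)\<^sup>2 + ((Q\<^sup>T *\<^sub>v g) $ 1)\<^sup>2"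
    using Q by (simp add: scalar_prod_def numeral_2_eq_2 power2_eq_square del: index_mult_mat_vec)
  then show ?thesis
    by (simp add: l2_norm_def cmod_def entry del: index_mult_mat_vec)
qed

text \<open>The form at z counts once and the form at g z^2 one half, together
  \<open>3 / 2 * B\<close>. The remaining scalar appears with a fixed sign, so the one-sided bound
  \<open>B'\<close> suffices.\<close>

lemma correlation_ge:
  fixes p q B B' :: real
  assumes crit: "second_order_critical n (centered n p q A) Q" and A: "A \<in> carrier_mat n n"
    and g: "balanced_labels n g" and pq: "q \<le> p"
    and B: "\<And>z. (\<And>i. i < n \<Longrightarrow> cmod (z i) = 1) \<Longrightarrow>
      \<bar>offdiag_form n (sbm_noise g p q A) (\<lambda>i j. Re (z i * cnj (z j)))\<bar> \<le> B"
    and B': "offdiag_form n (sbm_noise g p q A) (\<lambda>i j. - (g $ i * g $ j)) \<le> B'"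
  shows "(p - q) / 2 * ((real n)\<^sup>2 / 2) - 3 / 2 * B - B' / 2 \<le> (p - q) / 2 * (l2_norm (Q\<^sup>T *\<^sub>v g))\<^sup>2"
proof -
  let ?W = "sbm_noise g p q A" and ?s = "(p - q) / 2"
  let ?M = "centered n p q A"
  define z where "z i = Complex (Q $$ (i, 0)) (Q $$ (i, 1))" for i
  define x where "x i j = Re (z i * cnj (z j))" for i j
  have Q: "Q \<in> carrier_mat n 2" and row: "\<And>i. i < n \<Longrightarrow> l2_norm (row Q i) = 1"
    using crit by (auto simp: second_order_critical_def feasible_def)
  have gg: "g $ i * g $ i = 1" if "i < n" for i
    by (rule balanced_labels_square[OF g that])
  have sign: "g $ i = 1 \<or> g $ i = -1" if "i < n" for i
    using g that by (auto simp: balanced_labels_def)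
  have gc: "g \<in> carrier_vec n"
    using g by (simp add: balanced_labels_def)
  have z: "cmod (z i) = 1" if "i < n" for i
  proof -
    have "row Q i \<bullet> row Q i = (Re (z i))\<^sup>2 + (Im (z i))\<^sup>2"
      using Q that by (simp add: z_def scalar_prod_def numeral_2_eq_2 power2_eq_square)
    then show ?thesis
      using row[OF that] by (simp add: l2_norm_def cmod_def)
  qed
  \<comment> \<open>Subtracting \<open>(p + q) / 2\<close> from the mean \<open>p\<close> or
    \<open>q\<close> leaves \<open>?s\<close> with the sign of \<open>g $ i * g $ j\<close>.\<close>
  have M: "?M $$ (i, j) = ?W i j + ?s * (g $ i * g $ j)" if "i < n" "j < n" for i j
    using A that sign[of i] sign[of j]
    by (auto simp: centered_def ones_mat_def sbm_noise_def field_simps)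
  let ?y = "\<lambda>i j. x i j - g $ i * g $ j * (x i j)\<^sup>2"
  have "0 \<le> (\<Sum>i<n. \<Sum>j<n. ?M $$ (i, j) * ?y i j)"
    by (rule second_order_critical_test[OF crit])
      (use A gg in \<open>auto simp: centered_def ones_mat_def x_def z_def\<close>)
  also have "\<dots> = (\<Sum>i<n. \<Sum>j<n. ?W i j * ?y i j + ?s * (g $ i * g $ j * x i j) - ?s * (x i j)\<^sup>2)"
  proof (intro sum.cong refl)
    fix i j assume ij: "i \<in> {..<n}" "j \<in> {..<n}"
    then have "g $ i * g $ j * (g $ i * g $ j) = 1"
      using gg[of i] gg[of j] by (simp add: mult.assoc mult.left_commute)
    then have "g $ i * g $ j * ?y i j = g $ i * g $ j * x i j - (x i j)\<^sup>2"
      by (simp add: right_diff_distrib mult.assoc[symmetric])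
    then have "?s * (g $ i * g $ j) * ?y i j = ?s * (g $ i * g $ j * x i j) - ?s * (x i j)\<^sup>2"
      by (metis mult.assoc right_diff_distrib)
    then show "?M $$ (i, j) * ?y i j
        = ?W i j * ?y i j + ?s * (g $ i * g $ j * x i j) - ?s * (x i j)\<^sup>2"
      using ij by (simp only: M lessThan_iff distrib_right)
  qed
  also have "\<dots> = (\<Sum>i<n. \<Sum>j<n. ?W i j * ?y i j) + ?s * (\<Sum>i<n. \<Sum>j<n. g $ i * g $ j * x i j)
      - ?s * (\<Sum>i<n. \<Sum>j<n. (x i j)\<^sup>2)"
    by (simp only: sum_subtractf sum.distrib sum_distrib_left)
  also have "(\<Sum>i<n. \<Sum>j<n. g $ i * g $ j * x i j)
      = (\<Sum>i<n. \<Sum>j<n. Re (of_real (g $ i) * z i * cnj (of_real (g $ j) * z j)))"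
    by (simp add: x_def algebra_simps)
  also have "\<dots> = (l2_norm (Q\<^sup>T *\<^sub>v g))\<^sup>2"
    unfolding sum_Re_mult_cnj l2_norm_transpose_mult[OF Q gc] z_def ..
  \<comment> \<open>\<open>?y\<close> vanishes on the diagonal because the rows are unit
    vectors.\<close>
  also have "(\<Sum>i<n. \<Sum>j<n. ?W i j * ?y i j) = offdiag_form n ?W ?y"
  proof -
    have "(\<Sum>j<n. ?W i j * ?y i j) = (\<Sum>j\<in>{..<n} - {i}. ?W i j * ?y i j)" if "i < n" for i
    proof -
      have "x i i = 1"
        using z[OF that] Re_mult_cnj_square[OF z[OF that] z[OF that]]
        by (metis Re_complex_of_real complex_norm_square one_power2 x_def)
      then have "?y i i = 0"
        using gg[OF that] by simp
      then show ?thesis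
        using that by (subst sum.remove[of _ i]) auto
    qed
    then show ?thesis
      by (simp add: offdiag_form_def)
  qed
  \<comment> \<open>The half-angle formula splits the squared term; the labels are absorbed into the
    unit numbers g z^2, so that \<open>B\<close> applies again.\<close>
  also have "offdiag_form n ?W ?y = offdiag_form n ?W x
      + offdiag_form n ?W (\<lambda>i j. - (g $ i * g $ j)) / 2
      - offdiag_form n ?W (\<lambda>i j. Re (of_real (g $ i) * (z i)\<^sup>2 * cnj (of_real (g $ j) * (z j)\<^sup>2))) / 2"
    (is "_ = _ + ?g / 2 - ?d / 2")
  proof -
    have "?W i j * ?y i j = ?W i j * x i j + ?W i j * - (g $ i * g $ j) / 2
        - ?W i j * Re (of_real (g $ i) * (z i)\<^sup>2 * cnj (of_real (g $ j) * (z j)\<^sup>2)) / 2"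
      if "i < n" "j < n" for i j
    proof -
      have "Re (of_real (g $ i) * (z i)\<^sup>2 * cnj (of_real (g $ j) * (z j)\<^sup>2))
          = g $ i * g $ j * Re ((z i)\<^sup>2 * cnj ((z j)\<^sup>2))"
        by (simp add: algebra_simps)
      moreover have "(x i j)\<^sup>2 = (1 + Re ((z i)\<^sup>2 * cnj ((z j)\<^sup>2))) / 2"
        unfolding x_def by (intro Re_mult_cnj_square z that)
      ultimately show ?thesis
        by (simp only:) (simp add: field_simps)
    qed
    then show ?thesis
      unfolding offdiag_form_def
      by (simp only: sum.distrib[symmetric] sum_subtractf[symmetric] sum_divide_distrib)
        (intro sum.cong refl; simp)
  qed
  finally have main: "0 \<le> offdiag_form n ?W x + ?g / 2 - ?d / 2
      + ?s * (l2_norm (Q\<^sup>T *\<^sub>v g))\<^sup>2 - ?s * (\<Sum>i<n. \<Sum>j<n. (x i j)\<^sup>2)" .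
  have "\<bar>offdiag_form n ?W x\<bar> \<le> B"
    unfolding x_def[abs_def] by (rule B) (rule z)
  moreover have "\<bar>?d\<bar> \<le> B"
  proof (rule B)
    show "cmod (of_real (g $ i) * (z i)\<^sup>2) = 1" if "i < n" for i
      using z[OF that] sign[OF that] by (auto simp: norm_mult norm_power)
  qed
  moreover have "?s * ((real n)\<^sup>2 / 2) \<le> ?s * (\<Sum>i<n. \<Sum>j<n. (x i j)\<^sup>2)"
  proof (rule mult_left_mono)
    have "(\<Sum>i<n. \<Sum>j<n. (x i j)\<^sup>2) = ((real n)\<^sup>2 + (cmod (\<Sum>i<n. (z i)\<^sup>2))\<^sup>2) / 2"
      unfolding x_def by (rule sum_Re_mult_cnj_square[OF z])
    then show "(real n)\<^sup>2 / 2 \<le> (\<Sum>i<n. \<Sum>j<n. (x i j)\<^sup>2)"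
      by simp
  qed (use pq in simp)
  ultimately show ?thesis
    using main B' by linarith
qed

section \<open>Numerical constants and conclusion\<close>

lemma cos_pi_8_square_ge: "(cos (pi / 8))\<^sup>2 \<ge> 0.8535"
proof -
  have "cos (pi / 4) = 2 * (cos (pi / 8))\<^sup>2 - 1"
    using cos_double_cos[of "pi / 8"] by simp
  then have "(cos (pi / 8))\<^sup>2 = (1 + sqrt 2 / 2) / 2"
    by (simp add: cos_45 field_simps)
  moreover have "sqrt 2 \<ge> (1.414 :: real)"
    by (rule real_le_rsqrt) (simp add: power2_eq_square)
  ultimately show ?thesis by simp
qed

text \<open>Three times the rational bound 25/36 for \<open>ln 2\<close>.\<close>

lemma eight_power_le: "8 ^ n \<le> exp (25 / 12 * real n)"
proof -
  have "(2::real) \<le> exp (25 / 36)"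
    using ln2_le_25_over_36 by (metis exp_le_cancel_iff exp_ln zero_less_numeral)
  then have "(2::real) ^ 3 \<le> exp (25 / 36) ^ 3"
    by (rule power_mono) simp
  also have "exp (25 / 36 :: real) ^ 3 = exp (25 / 12)"
    using exp_of_nat_mult[of 3 "25 / 36 :: real"] by simp
  finally have "(8::real) ^ n \<le> exp (25 / 12) ^ n"
    by (intro power_mono) auto
  then show ?thesis
    by (simp only: exp_of_nat2_mult)
qed

text \<open>For t = c / sqrt a the product t^2 a is c^2, and \<open>sqrt a\<close> at least 1000
  keeps \<open>exp (2 * t)\<close> below 1.02.\<close>

lemma chernoff_parameter:
  fixes a c :: real
  assumes a: "10 ^ 6 \<le> a" and c: "0 \<le> c" "c \<le> 1.4" and n: "n > 0"
  shows "(c / sqrt a)\<^sup>2 * exp (2 * (c / sqrt a)) * (a / real n) \<le> 1.02 * c\<^sup>2 / real n"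
proof -
  let ?t = "c / sqrt a"
  have s: "sqrt a \<ge> 1000"
    using a by (intro real_le_rsqrt) simp
  have "0 \<le> ?t"
    using a c by (intro divide_nonneg_nonneg) auto
  moreover have "?t \<le> 1.4 / 1000"
    using c s by (intro frac_le) auto
  ultimately have t: "0 \<le> ?t" "?t \<le> 1.4 / 1000" .
  have "exp (2 * ?t) \<le> 1 + 2 * ?t + (2 * ?t)\<^sup>2"
    by (rule exp_bound) (use t in linarith)+
  also have "\<dots> \<le> 1 + 2 * (1.4 / 1000) + (2 * (1.4 / 1000))\<^sup>2"
    using t by (intro add_mono mult_left_mono power_mono) auto
  also have "\<dots> \<le> 1.02"
    by (simp add: power2_eq_square)
  finally have "exp (2 * ?t) \<le> 1.02" .
  then have "c\<^sup>2 / real n * exp (2 * ?t) \<le> c\<^sup>2 / real n * 1.02"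
    by (intro mult_left_mono) auto
  moreover have "?t\<^sup>2 * exp (2 * ?t) * (a / real n) = c\<^sup>2 / real n * exp (2 * ?t)"
    using a by (simp add: power_divide)
  moreover have "c\<^sup>2 / real n * 1.02 = 1.02 * c\<^sup>2 / real n"
    by simp
  ultimately show ?thesis
    by (simp only:)
qed

text \<open>The factor 1.4 nearly exhausts the condition \<open>tp\<close>, as 1.02 * 1.4^2 =
  1.9992. The exponent per node is then 25/12 + 1 - 1.4 * 2.21, just below -1/100.\<close>

lemma prob_noise_form_gt_decay:
  fixes a b :: real
  assumes "0 \<le> b" "b < a" "10 ^ 6 \<le> a" "a \<le> real n" "n > 0"
  shows "measure_pmf.prob (sbm_pmf n g (a / real n) (b / real n))
      {A. \<exists>z. (\<forall>i<n. cmod (z i) = 1) \<and> 2.21 * real n * sqrt a / (cos (pi / 8))\<^sup>2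
        < \<bar>offdiag_form n (sbm_noise g (a / real n) (b / real n) A) (\<lambda>i j. Re (z i * cnj (z j)))\<bar>}
    \<le> 2 * (2 * real n + 1)\<^sup>2 * exp (- (real n / 100))"
    (is "?P \<le> _")
proof -
  let ?t = "1.4 / sqrt a"
  have "?t\<^sup>2 * exp (2 * ?t) * (a / real n) \<le> 1.02 * 1.4\<^sup>2 / real n"
    by (rule chernoff_parameter) (use assms in auto)
  also have "\<dots> \<le> 2 / real n"
    by (intro divide_right_mono) (auto simp: power2_eq_square)
  finally have "?P \<le> 2 * (2 * real n + 1)\<^sup>2 * 8 ^ n * exp (real n - ?t * (2.21 * real n * sqrt a))"
    using assms by (intro prob_noise_form_gt) (auto simp: divide_right_mono)
  also have "\<dots> \<le> 2 * (2 * real n + 1)\<^sup>2 * exp (25 / 12 * real n) * exp (real n - ?t * (2.21 * real n * sqrt a))"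
    by (intro mult_right_mono mult_left_mono eight_power_le) auto
  also have "\<dots> = 2 * (2 * real n + 1)\<^sup>2 * exp (25 / 12 * real n + (real n - ?t * (2.21 * real n * sqrt a)))"
    by (simp only: exp_add mult.assoc)
  also have "?t * (2.21 * real n * sqrt a) = 3.094 * real n"
    using assms by simp
  also have "2 * (2 * real n + 1)\<^sup>2 * exp (25 / 12 * real n + (real n - 3.094 * real n))
      \<le> 2 * (2 * real n + 1)\<^sup>2 * exp (- (real n / 100))"
    by (intro mult_left_mono) auto
  finally show ?thesis .
qed

text \<open>A single fixed matrix needs no union bound, so a small threshold suffices: 1.02 * 0.04^2
  - 0.04 * 0.05 is below -1/10000.\<close>

lemma prob_label_form_ge_decay:
  fixes a b :: real
  assumes "0 \<le> b" "b < a" "10 ^ 6 \<le> a" "a \<le> real n" "n > 0" and g: "balanced_labels n g"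
  shows "measure_pmf.prob (sbm_pmf n g (a / real n) (b / real n))
      {A. 0.05 * real n * sqrt a
        \<le> offdiag_form n (sbm_noise g (a / real n) (b / real n) A) (\<lambda>i j. - (g $ i * g $ j))}
    \<le> exp (- (real n / 10000))"
    (is "?P \<le> _")
proof -
  let ?t = "0.04 / sqrt a"
  let ?S = "\<Sum>i<n. \<Sum>j<n. (- (g $ i * g $ j))\<^sup>2"
  have sign: "g $ i = 1 \<or> g $ i = -1" if "i < n" for i
    using g that by (auto simp: balanced_labels_def)
  have "?P \<le> exp (?t\<^sup>2 * exp (2 * ?t) * (a / real n) * ?S - ?t * (0.05 * real n * sqrt a))"
  proof (rule chernoff_sbm)
    show "\<bar>- (g $ i * g $ j)\<bar> \<le> 1" if "i < n" "j < n" for i j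
      using sign[OF that(1)] sign[OF that(2)] by auto
  qed (use assms in \<open>auto simp: divide_right_mono mult.commute\<close>)
  also have "?S = (\<Sum>i<n. \<Sum>j<n. 1)"
  proof (intro sum.cong refl)
    fix i j assume "i \<in> {..<n}" "j \<in> {..<n}"
    then show "(- (g $ i * g $ j))\<^sup>2 = 1"
      using sign[of i] sign[of j] by auto
  qed
  also have "\<dots> = real n * real n"
    by simp
  also have "?t * (0.05 * real n * sqrt a) = 0.002 * real n"
    using assms by simp
  also have "exp (?t\<^sup>2 * exp (2 * ?t) * (a / real n) * (real n * real n) - 0.002 * real n)
      \<le> exp (1.02 * 0.04\<^sup>2 / real n * (real n * real n) - 0.002 * real n)"
    using assms by (subst exp_le_cancel_iff, intro diff_right_mono mult_right_mono chernoff_parameter) auto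
  also have "1.02 * 0.04\<^sup>2 / real n * (real n * real n) - 0.002 * real n \<le> - (real n / 10000)"
    using assms by (simp add: power2_eq_square)
  finally show ?thesis by simp
qed

text \<open>Divided by \<open>N\<close>, the claim reads: noise at most (1/2 - 1/400) y, with y = (a
  - b) / 2. The noise is of order \<open>sqrt a\<close>, while \<open>snr\<close> is normalised by
  \<open>D\<close>, twice the root of the mean degree.\<close>

lemma signal_dominates_noise:
  fixes a b N :: real
  assumes "0 \<le> b" "b < a" "(a + b) / 2 > 10 ^ 6" "snr a b > 8" "N > 0"
  shows "(a / N - b / N) / 2 * (N / 20)\<^sup>2 \<le> (a / N - b / N) / 2 * (N\<^sup>2 / 2)
    - 3 / 2 * (2.21 * N * sqrt a / (cos (pi / 8))\<^sup>2) - 0.05 * N * sqrt a / 2"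
proof -
  define D where "D = sqrt (2 * (a + b))"
  define y where "y = (a - b) / 2"
  have D: "D > 2000"
    unfolding D_def using assms by (intro real_less_rsqrt) simp
  have D2: "D\<^sup>2 = 2 * (a + b)"
    unfolding D_def using assms by simp
  have "8 * D < a - b"
    using assms(4) D unfolding snr_def D_def[symmetric] by (simp add: pos_less_divide_eq)
  then have y: "4 * D < y"
    by (simp add: y_def)
  \<comment> \<open>Completing the square in a = D^2/4 + y; the correction \<open>y / D\<close> is
    negligible against \<open>y\<close> since \<open>D\<close> is large.\<close>
  have "(D / 2 + y / D)\<^sup>2 = D\<^sup>2 / 4 + y + (y / D)\<^sup>2"
    using D by (simp add: power2_eq_square field_simps)
  also have "\<dots> \<ge> a"
    unfolding D2 y_def by (simp add: field_simps)
  finally have "sqrt a \<le> D / 2 + y / D"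
    using D y by (intro real_le_lsqrt) auto
  moreover have "y / D \<le> y / 2000"
    using D y by (intro divide_left_mono) auto
  \<comment> \<open>From D/2 < y/8 and 3.91 * (1/8 + 1/2000) < 0.4975.\<close>
  ultimately have sq: "391 / 100 * sqrt a \<le> 199 / 400 * y"
    using y D by linarith
  \<comment> \<open>The total noise coefficient 3/2 * 2.21 / 0.8535 + 1/40 stays just below
    3.91.\<close>
  have "2.21 / (cos (pi / 8))\<^sup>2 \<le> 2.21 / 0.8535"
    using cos_pi_8_square_ge by (intro divide_left_mono) auto
  then have "(3 / 2 * (2.21 / (cos (pi / 8))\<^sup>2) + 1 / 40) * sqrt a \<le> 391 / 100 * sqrt a"
    using assms by (intro mult_right_mono) auto
  also note sq
  finally have "N * ((3 / 2 * (2.21 / (cos (pi / 8))\<^sup>2) + 1 / 40) * sqrt a) \<le> N * (199 / 400 * y)"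
    using assms by (intro mult_left_mono) auto
  moreover have "N * ((3 / 2 * (2.21 / (cos (pi / 8))\<^sup>2) + 1 / 40) * sqrt a)
      = 3 / 2 * (2.21 * N * sqrt a / (cos (pi / 8))\<^sup>2) + N * sqrt a / 40"
    by (simp add: distrib_left distrib_right)
  moreover have "(a / N - b / N) / 2 * (N\<^sup>2 / 2) = N * y / 2"
    and "(a / N - b / N) / 2 * (N / 20)\<^sup>2 = N * y / 400"
    using assms by (simp_all add: y_def power2_eq_square field_simps)
  moreover have "0.05 * N * sqrt a / 2 = N * sqrt a / 40"
    by simp
  moreover have "N * (199 / 400 * y) = 199 / 400 * (N * y)"
    by simp
  moreover have "u + v \<le> 199 / 400 * w \<Longrightarrow> w / 400 \<le> w / 2 - u - v" for u v w :: real
    by linarith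
  ultimately show ?thesis
    by (simp only:)
qed

theorem theorem5:
  shows "\<forall>\<delta>>0. \<exists>d0::real. \<forall>a b::real.
    a > b \<and> b \<ge> 0 \<and> (a + b) / 2 > d0 \<and> snr a b > 8 + \<delta> \<longrightarrow>
    (\<exists>\<epsilon>>0. \<forall>g :: nat \<Rightarrow> real vec. (\<forall>m. balanced_labels (2 * m) (g m)) \<longrightarrow>
      (\<lambda>m. let n = 2 * m; p = a / real n; q = b / real n in
         measure_pmf.prob (sbm_pmf n (g m) p q)
           {A. \<forall>Q. second_order_critical n (centered n p q A) Q \<longrightarrow>
                 l2_norm (Q\<^sup>T *\<^sub>v g m) / real n \<ge> \<epsilon>})
      \<longlonglongrightarrow> 1)"
\<comment> \<open>\<open>10 ^ 6\<close> bounds the mean degree, hence also \<open>a\<close>, from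
  below, as the numerical estimates require. The correlation \<open>1 / 20\<close> costs only the
  share 1/400 of the signal.\<close>
proof (rule allI, rule impI, rule exI[of _ "10 ^ 6"], intro allI impI, rule exI[of _ "1 / 20"],
    intro conjI allI impI)
  fix \<delta> a b :: real and g :: "nat \<Rightarrow> real vec"
  assume "\<delta> > 0" and ab: "a > b \<and> b \<ge> 0 \<and> (a + b) / 2 > 10 ^ 6 \<and> snr a b > 8 + \<delta>"
    and g: "\<forall>m. balanced_labels (2 * m) (g m)"
  then have a: "0 \<le> b" "b < a" "10 ^ 6 \<le> a" "snr a b > 8"
    by auto
  let ?prob = "\<lambda>m. let n = 2 * m; p = a / real n; q = b / real n in
         measure_pmf.prob (sbm_pmf n (g m) p q)
           {A. \<forall>Q. second_order_critical n (centered n p q A) Q \<longrightarrow>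
                 l2_norm (Q\<^sup>T *\<^sub>v g m) / real n \<ge> 1 / 20}"
  let ?err = "\<lambda>n::real. 2 * (2 * n + 1)\<^sup>2 * exp (- (n / 100)) + exp (- (n / 10000))"
  \<comment> \<open>Only for n at least \<open>a\<close> is a/n a probability, so the bound holds
    eventually.\<close>
  have lower: "1 - ?err (real (2 * m)) \<le> ?prob m" if m: "m > 0" "a \<le> real (2 * m)" for m
  proof -
    define n where "n = 2 * m"
    let ?p = "a / real n" and ?q = "b / real n"
    let ?M = "sbm_pmf n (g m) ?p ?q"
    let ?W = "sbm_noise (g m) ?p ?q"
    let ?u = "2.21 * real n * sqrt a / (cos (pi / 8))\<^sup>2"
    let ?good = "{A. \<forall>Q. second_order_critical n (centered n ?p ?q A) Q \<longrightarrow>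
                 l2_norm (Q\<^sup>T *\<^sub>v g m) / real n \<ge> 1 / 20}"
    let ?bad1 = "{A. \<exists>z. (\<forall>i<n. cmod (z i) = 1) \<and>
        ?u < \<bar>offdiag_form n (?W A) (\<lambda>i j. Re (z i * cnj (z j)))\<bar>}"
    let ?bad2 = "{A. 0.05 * real n * sqrt a \<le> offdiag_form n (?W A) (\<lambda>i j. - (g m $ i * g m $ j))}"
    have n: "n > 0" "a \<le> real n"
      using m by (auto simp: n_def)
    have labels: "balanced_labels n (g m)"
      using g by (simp add: n_def)
    have pq: "?q < ?p"
      using a n by (simp add: divide_strict_right_mono)
    have "- ?good \<inter> set_pmf ?M \<subseteq> ?bad1 \<union> ?bad2"
    proof (rule subsetI, rule ccontr)
      fix A assume A: "A \<in> - ?good \<inter> set_pmf ?M" and nb: "A \<notin> ?bad1 \<union> ?bad2"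
      then obtain Q where crit: "second_order_critical n (centered n ?p ?q A) Q"
        and small: "l2_norm (Q\<^sup>T *\<^sub>v g m) / real n < 1 / 20"
        by (auto simp: not_le)
      have "(?p - ?q) / 2 * (real n / 20)\<^sup>2
          \<le> (?p - ?q) / 2 * ((real n)\<^sup>2 / 2) - 3 / 2 * ?u - 0.05 * real n * sqrt a / 2"
        using a ab n by (intro signal_dominates_noise) auto
      also have "\<dots> \<le> (?p - ?q) / 2 * (l2_norm (Q\<^sup>T *\<^sub>v g m))\<^sup>2"
      proof (rule correlation_ge[OF crit _ labels])
        show "\<bar>offdiag_form n (?W A) (\<lambda>i j. Re (z i * cnj (z j)))\<bar> \<le> ?u"
          if "\<And>i. i < n \<Longrightarrow> cmod (z i) = 1" for z
          using nb that by (auto simp: not_less)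
      qed (use A nb pq in \<open>auto intro: set_sbm_pmf\<close>)
      \<comment> \<open>Cancels the positive factor (p - q) / 2.\<close>
      finally have "(real n / 20)\<^sup>2 \<le> (l2_norm (Q\<^sup>T *\<^sub>v g m))\<^sup>2"
        using pq by (simp add: mult_le_cancel_left_pos)
      moreover have "0 \<le> l2_norm (Q\<^sup>T *\<^sub>v g m)"
        by (simp add: l2_norm_def scalar_prod_def sum_nonneg)
      ultimately have "real n / 20 \<le> l2_norm (Q\<^sup>T *\<^sub>v g m)"
        by (rule power2_le_imp_le)
      then show False
        using small n by (simp add: field_simps)
    qed
    then have "measure_pmf.prob ?M (- ?good \<inter> set_pmf ?M) \<le> measure_pmf.prob ?M (?bad1 \<union> ?bad2)"
      by (intro measure_pmf.finite_measure_mono) auto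
    also have "\<dots> \<le> measure_pmf.prob ?M ?bad1 + measure_pmf.prob ?M ?bad2"
      by (rule measure_Un_le) auto
    also have "\<dots> \<le> ?err (real n)"
      using a n labels by (intro add_mono prob_noise_form_gt_decay prob_label_form_ge_decay) auto
    finally have "measure_pmf.prob ?M (- ?good) \<le> ?err (real n)"
      by (simp add: measure_Int_set_pmf)
    moreover have "measure_pmf.prob ?M (- ?good) = 1 - measure_pmf.prob ?M ?good"
      using measure_pmf.prob_compl[of ?good ?M] by (simp add: Compl_eq_Diff_UNIV)
    ultimately show ?thesis
      by (simp add: Let_def n_def)
  qed
  show "?prob \<longlonglongrightarrow> 1"
  proof (rule tendsto_sandwich)
    show "\<forall>\<^sub>F m in sequentially. 1 - ?err (real (2 * m)) \<le> ?prob m"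
    proof (rule eventually_sequentiallyI)
      fix m assume "nat \<lceil>a\<rceil> + 1 \<le> m"
      then show "1 - ?err (real (2 * m)) \<le> ?prob m"
        by (intro lower) linarith+
    qed
    show "\<forall>\<^sub>F m in sequentially. ?prob m \<le> 1"
      by (simp add: Let_def)
    show "(\<lambda>m. 1 - ?err (real (2 * m))) \<longlonglongrightarrow> 1"
      by real_asymp
  qed simp
qed simp

end
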